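(* Let $f\colon\mathbb{Z}_0^+\to\mathbb{Z}^+$ be a function and let $a$ and $e$ be positive integers. Let $G$ be a graph, $r\colon V(G)\to\mathbb{R}^+$ a function, and $\prec$ a linear ordering of $V(G)$ such that $u\prec v$ implies $r(u)\ge r(v)$. If $(G,r)$ has the property $P(f,a,e)$, then $$\mathrm{wcol}_{\prec,k}(G)\le \max(1,\lceil\log_2 k\rceil)\, f(2k-2)\binom{k+e+2}{e+2}$$ for every integer $k\ge a$.
   Context: Graphs are finite, simple, undirected. For $G$, $r\colon V(G)\to\mathbb{R}^+$ and $u,v\in V(G)$, $\lambda_r(u,v)$ is the minimum of $\sum_{x\in V(Q)\setminus\{u,v\}} r(x)$ over all paths $Q$ from $u$ to $v$ in $G$. For $f\colon\mathbb{Z}_0^+\to\mathbb{Z}^+$ and positive integers $a,e$, $(G,r)$ has the property $P(f,a,e)$ if (i) for each $v\in V(G)$ and integers $s\ge1$, $p\ge0$, there are at most $f(p)$ vertices $u$ with $r(u)\ge s\,r(v)$ and $\lambda_r(u,v)\le ps\,r(v)$; and (ii) for each $v\in V(G)$ and each positive integer $s$, every sequence $u_1,u_2,\ldots$ of distinct vertices with $\lambda_r(u_i,v)\le s\,r(v)$ and $r(u_i)\ge a^i s\,r(v)$ for each $i$ has length at most $e$. For a linear ordering $\prec$ and integer $k\ge0$, $u$ is weakly $k$-reachable from $v$ if $u\preceq v$ and there is a path from $v$ to $u$ of length at most $k$ with all internal vertices greater than $u$; $\mathrm{wcol}_{\prec,k}(G)$ is the maximum over $v\in V(G)$ of the number of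 vertices weakly $k$-reachable from $v$. *)

theory Defs
  imports Complex_Main "HOL-Library.Extended_Real" "Graph_Theory.Graph_Theory"
begin

text \<open>
  A finite simple undirected graph is a symmetric digraph satisfying the locale predicate
  \<^term>\<open>graph\<close>.  Paths are vertex paths (\<^const>\<open>vpath\<close>), so the path with a single vertex
  joins that vertex to itself.
\<close>

definition paths_between :: "('a, 'b) pre_digraph \<Rightarrow> 'a \<Rightarrow> 'a \<Rightarrow> 'a vwalk set" where
  "paths_between G u v = {q. vpath q G \<and> hd q = u \<and> last q = v}"

text \<open>
  The value is \<open>\<infinity>\<close> if no path joins \<open>u\<close> to \<open>v\<close>.  Otherwise, in a finite graph, the infimum is
  over a finite nonempty set and hence a minimum.
\<close>

definition lambda_dist ::
  "('a, 'b) pre_digraph \<Rightarrow> ('a \<Rightarrow> real) \<Rightarrow> 'a \<Rightarrow> 'a \<Rightarrow> ereal" where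
  "lambda_dist G r u v = (INF q \<in> paths_between G u v. ereal (\<Sum>x \<in> set q - {u, v}. r x))"

text \<open>
  In the second condition the list entry \<open>us ! i\<close> is the term with index \<open>i + 1\<close> of the sequence
  \<open>u\<^sub>1, u\<^sub>2, \<dots>\<close>.  The terms are distinct vertices of a finite graph, so all sequences are finite.
\<close>

definition property_P ::
  "('a, 'b) pre_digraph \<Rightarrow> ('a \<Rightarrow> real) \<Rightarrow> (nat \<Rightarrow> nat) \<Rightarrow> nat \<Rightarrow> nat \<Rightarrow> bool" where
  "property_P G r f a e \<longleftrightarrow>
    (\<forall>v \<in> verts G. \<forall>s p :: nat. s \<ge> 1 \<longrightarrow>
      card {u \<in> verts G. r u \<ge> real s * r v \<and>
        lambda_dist G r u v \<le> ereal (real p * real s * r v)} \<le> f p) \<and>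
    (\<forall>v \<in> verts G. \<forall>s :: nat. s \<ge> 1 \<longrightarrow>
      (\<forall>us. set us \<subseteq> verts G \<and> distinct us \<and>
        (\<forall>i < length us. lambda_dist G r (us ! i) v \<le> ereal (real s * r v) \<and>
          r (us ! i) \<ge> real a ^ (i + 1) * real s * r v)
        \<longrightarrow> length us \<le> e))"

text \<open>
  The linear ordering is given by its reflexive relation \<open>R\<close>: \<open>(x, y) \<in> R\<close> means \<open>x \<preceq> y\<close>.
\<close>

definition weakly_reachable ::
  "('a, 'b) pre_digraph \<Rightarrow> 'a rel \<Rightarrow> nat \<Rightarrow> 'a \<Rightarrow> 'a \<Rightarrow> bool" where
  "weakly_reachable G R k v u \<longleftrightarrow> (u, v) \<in> R \<and>
    (\<exists>q \<in> paths_between G v u. vwalk_length q \<le> k \<and>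
      (\<forall>x \<in> set q - {v, u}. (u, x) \<in> R \<and> x \<noteq> u))"

text \<open>The inserted \<open>0\<close> matters only for the graph without vertices.\<close>

definition wcol :: "('a, 'b) pre_digraph \<Rightarrow> 'a rel \<Rightarrow> nat \<Rightarrow> nat" where
  "wcol G R k =
    Max (insert 0 ((\<lambda>v. card {u \<in> verts G. weakly_reachable G R k v u}) ` verts G))"

end

theory Submission
  imports Defs
begin

text \<open>
  Fix \<open>v\<close> and let \<open>K = 2 ^ b\<close> with \<open>b = max 1 \<lceil>log 2 k\<rceil>\<close>, so that \<open>K \<ge> k \<ge> a\<close>.  Split the
  vertices \<open>u\<close> weakly \<open>k\<close>-reachable from \<open>v\<close> into levels by \<open>K ^ j \<le> r u / r v < K ^ (j + 1)\<close>.
  Every level consists of \<open>b\<close> dyadic classes, each of which has at most \<open>f (2k - 2)\<close> elements by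
  condition (i).  It remains to bound the number of occupied levels.

  The depth of a level is the least number of steps in which some \<open>u\<close> in it is weakly reachable
  from \<open>v\<close>.  The least vertex \<open>w\<close> before the end of a path attaining the depth is weakly reachable
  in fewer steps; call its level the parent of the level of \<open>u\<close>.  The internal vertices of the path
  have radius at most \<open>r w\<close>, so if the parent is at most \<open>i\<close>, then the path has cost at most
  \<open>K ^ (i + 2) * r v\<close>.  Hence by condition (ii) at most \<open>e + 2\<close> levels above \<open>i\<close> have a parent
  at most \<open>i\<close>, the first two being too close to \<open>i\<close> for (ii) to apply.  A forest on the levels of
  depth at most \<open>k\<close>, such that at most \<open>c\<close> edges pass over any level, has at most
  \<open>(k + c) choose c\<close> vertices.
\<close>

section \<open>Forests of levels with bounded cuts\<close>

lemma card_le_choose_of_bounded_cuts: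
  fixes L :: "nat set" and d p :: "nat \<Rightarrow> nat"
  assumes fin: "finite L"
    and depth: "\<And>j. j \<in> L \<Longrightarrow> d j \<le> k"
    and parent: "\<And>j. j \<in> L \<Longrightarrow> j \<noteq> 0 \<Longrightarrow> p j \<in> L \<and> p j < j \<and> d (p j) < d j"
    and cut: "\<And>i. i \<in> L \<Longrightarrow> card {j \<in> L. i < j \<and> p j \<le> i} \<le> c"
  shows "card L \<le> (k + c) choose c"
proof -
  \<comment> \<open>Passing from \<open>i\<close> to the next level replaces one pending level by deeper ones, so the vector of
    the numbers of pending levels by depth decreases lexicographically; hence these vectors,
    padded to have sum \<open>c\<close>, are pairwise distinct.\<close>
  define pend where "pend i = {j \<in> L. i < j \<and> p j \<le> i}" for i
  define cnt where "cnt i \<delta> = card {j \<in> pend i. d j = \<delta>}" for i \<delta>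
  \<comment> \<open>Only the depths \<open>1\<close> to \<open>k\<close> are listed: a pending level
    exceeds \<open>i\<close>, so it is nonzero and lies deeper than its parent. With the padding
    entry the list has length \<open>k + 1\<close>.\<close>
  define F where "F i = (c - card (pend i)) # map (cnt i) [1..<Suc k]" for i
  define S where "S = {l :: nat list. length l = k + 1 \<and> sum_list l = c}"
  have fin_pend: "finite (pend i)" for i
    using fin by (simp add: pend_def)
  have neq: "F i \<noteq> F i'" if ii: "i \<in> L" "i' \<in> L" "i < i'" for i i'
  proof -
    define N where "N = {j \<in> L. i < j \<and> j \<le> i'}"
    have N: "finite N" "N \<noteq> {}" using ii fin by (auto simp: N_def)
    define \<delta> where "\<delta> = Min (d ` N)"
    have "\<delta> \<in> d ` N" unfolding \<delta>_def using N by (intro Min_in) auto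
    then obtain m where m: "m \<in> N" "d m = \<delta>" by auto
    have \<delta>_le: "\<delta> \<le> d j" if "j \<in> N" for j
      unfolding \<delta>_def using N that by (intro Min_le) auto
    have m': "m \<in> L" "i < m" "m \<le> i'" using m by (auto simp: N_def)
    \<comment> \<open>A level of depth \<delta> cannot have its parent in \<open>N\<close>, since
      the parent would be shallower than the minimum over \<open>N\<close>. So every level of depth
      \<delta> pending at \<open>i'\<close> was already pending at \<open>i\<close>, whereas
      \<open>m\<close> has been passed.\<close>
    have low: "p j \<le> i" if "j \<in> L" "j \<noteq> 0" "d j = \<delta>" "p j \<le> i'" for j
    proof (rule ccontr)
      assume "\<not> p j \<le> i"
      then have "p j \<in> N" using parent[of j] that by (auto simp: N_def)
      from \<delta>_le[OF this] show False using parent[of j] that by auto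
    qed
    have "p m < m" using parent[of m] m' by auto
    then have pm: "m \<in> pend i" using low[of m] m m' by (auto simp: pend_def)
    have "{j \<in> pend i'. d j = \<delta>} \<subseteq> {j \<in> pend i. d j = \<delta>}"
      using low ii by (auto simp: pend_def)
    moreover have "m \<notin> pend i'" using m' by (auto simp: pend_def)
    ultimately have "{j \<in> pend i'. d j = \<delta>} \<subset> {j \<in> pend i. d j = \<delta>}"
      using pm m by blast
    then have "cnt i' \<delta> < cnt i \<delta>"
      unfolding cnt_def by (intro psubset_card_mono) (auto simp: fin_pend)
    moreover have "\<delta> \<in> set [1..<Suc k]"
      using parent[of m] depth[of m] m m' by auto
    ultimately show ?thesis unfolding F_def by force
  qed
  have "inj_on F L"
    using neq by (intro linorder_inj_onI) (auto simp: eq_commute)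
  moreover have "F ` L \<subseteq> S"
  proof
    fix l assume "l \<in> F ` L"
    then obtain i where i: "i \<in> L" "l = F i" by auto
    have "sum_list (map (cnt i) [1..<Suc k]) = (\<Sum>\<delta>\<in>{1..<Suc k}. cnt i \<delta>)"
      by (simp add: interv_sum_list_conv_sum_set_nat del: upt_Suc)
    also have "\<dots> = (\<Sum>\<delta>\<in>{1..<Suc k}. card {j \<in> pend i. d j = \<delta>})"
      by (simp add: cnt_def)
    also have "\<dots> = card (\<Union>\<delta>\<in>{1..<Suc k}. {j \<in> pend i. d j = \<delta>})"
      by (subst card_UN_disjoint) (auto simp: fin_pend)
    also have "(\<Union>\<delta>\<in>{1..<Suc k}. {j \<in> pend i. d j = \<delta>}) = pend i"
    proof -
      have "1 \<le> d j \<and> d j < Suc k" if "j \<in> pend i" for j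
        using that parent[of j] depth[of j] by (auto simp: pend_def)
      then show ?thesis by auto
    qed
    finally show "l \<in> S"
      using i cut[OF i(1)] by (simp add: S_def F_def pend_def del: upt_Suc)
  qed
  moreover have cardS: "card S = (k + c) choose c"
    unfolding S_def by (subst card_length_sum_list) (simp add: add.commute)
  moreover have "finite S"
    using cardS by (intro card_ge_0_finite) simp
  ultimately show ?thesis
    by (metis card_inj_on_le)
qed

section \<open>Weak reachability and the cost of paths\<close>

lemma finite_linear_order_on_has_least:
  assumes "linear_order_on V R" "finite A" "A \<noteq> {}" "A \<subseteq> V"
  obtains w where "w \<in> A" "\<And>x. x \<in> A \<Longrightarrow> (w, x) \<in> R"
proof -
  have R: "refl_on V R" "trans R" "total_on V R"
    using assms(1) by (auto simp: order_on_defs)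
  have "\<exists>w\<in>A. \<forall>x\<in>A. (w, x) \<in> R"
    using assms(2-4)
  proof (induction rule: finite_ne_induct)
    case (singleton x)
    then show ?case using R by (auto simp: refl_on_def)
  next
    case (insert x A)
    then obtain w where w: "w \<in> A" "\<forall>y\<in>A. (w, y) \<in> R" by auto
    have "(x, x) \<in> R" using R insert.prems by (auto simp: refl_on_def)
    moreover have "(w, x) \<in> R \<or> (x, w) \<in> R"
      using R insert.prems w insert.hyps by (auto simp: total_on_def)
    ultimately show ?case using w R by (auto dest: transD)
  qed
  then show ?thesis using that by blast
qed

text \<open>Links the two directions in use: weak reachability follows paths from \<open>v\<close>
  to \<open>u\<close>, while \<open>property_P\<close> measures \<open>lambda_dist\<close> from
  \<open>u\<close> to \<open>v\<close>.\<close>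

lemma (in sym_digraph) paths_between_rev:
  assumes "q \<in> paths_between G u v"
  shows "rev q \<in> paths_between G v u"
proof -
  have "set (vwalk_arcs (rev q)) \<subseteq> arcs_ends G"
    using assms sym_arcs
    by (auto simp: set_vwalk_arcs_rev paths_between_def symmetric_def
        elim!: vpathE vwalkE dest!: symD)
  then show ?thesis
    using assms by (auto simp: paths_between_def vpath_def vwalk_def hd_rev last_rev)
qed

text \<open>Two distinct ends are removed from at most \<open>k + 1\<close> vertices; if
  \<open>u = v\<close>, the path is a single vertex and nothing remains.\<close>

lemma card_internal_vertices_le:
  assumes "q \<in> paths_between G u v" "vwalk_length q \<le> k"
  shows "card (set q - {u, v}) \<le> k - 1"
proof (cases "u = v")
  case True
  have "q \<noteq> []" "distinct q" "hd q = last q"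
    using assms True by (auto simp: paths_between_def vpath_def vwalk_def)
  then have "set q - {u, v} = {}"
    using assms by (cases q) (auto simp: paths_between_def split: if_splits)
  then show ?thesis by (metis card.empty le0)
next
  case False
  have "q \<noteq> []" "distinct q" "hd q = u" "last q = v"
    using assms by (auto simp: paths_between_def vpath_def vwalk_def)
  then have "card (set q - {u, v}) = length q - 2"
    using False by (subst card_Diff_subset) (auto simp: distinct_card)
  then show ?thesis using assms by simp
qed

lemma (in sym_digraph) lambda_dist_le:
  assumes q: "q \<in> paths_between G v u" "vwalk_length q \<le> k"
    and B: "0 \<le> B" "\<And>x. x \<in> set q - {v, u} \<Longrightarrow> r x \<le> B"
  shows "lambda_dist G r u v \<le> ereal (real (k - 1) * B)"
proof -
  have "lambda_dist G r u v \<le> ereal (\<Sum>x \<in> set (rev q) - {u, v}. r x)"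
    unfolding lambda_dist_def by (rule INF_lower[OF paths_between_rev[OF q(1)]])
  also have "(\<Sum>x \<in> set (rev q) - {u, v}. r x) \<le> real (card (set q - {v, u})) * B"
    using B(2) sum_bounded_above[of "set q - {v, u}" r B] by (simp add: insert_commute)
  also have "\<dots> \<le> real (k - 1) * B"
    using B(1) card_internal_vertices_le[OF q] by (intro mult_right_mono) auto
  finally show ?thesis by simp
qed

lemma weakly_reachable_mono:
  assumes "weakly_reachable G R d v u" "d \<le> k"
  shows "weakly_reachable G R k v u"
proof -
  from assms(1) obtain q where "q \<in> paths_between G v u" "vwalk_length q \<le> d" "(u, v) \<in> R"
    "\<forall>x \<in> set q - {v, u}. (u, x) \<in> R \<and> x \<noteq> u"
    unfolding weakly_reachable_def by blast
  moreover have "vwalk_length q \<le> k" using calculation(2) assms(2) by (rule order_trans)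
  ultimately show ?thesis unfolding weakly_reachable_def by blast
qed

text \<open>As \<open>w\<close> is least among all vertices before \<open>u\<close>, the initial
  segment of \<open>q\<close> ending at \<open>w\<close> witnesses its weak reachability, and it is
  shorter because \<open>u\<close> comes later. The last conclusion serves to bound the radii along
  \<open>q\<close> by \<open>r w\<close>.\<close>

lemma weakly_reachable_least_vertex_before_end:
  assumes lin: "linear_order_on (verts G) R"
    and wr: "weakly_reachable G R d v u" and "u \<noteq> v"
  obtains q w d' where "q \<in> paths_between G v u" "vwalk_length q \<le> d" "d' < d"
    "w \<in> verts G" "weakly_reachable G R d' v w" "(u, w) \<in> R" "w \<noteq> u"
    "\<And>x. x \<in> set q - {u} \<Longrightarrow> (w, x) \<in> R"
proof -
  from wr obtain q where q: "q \<in> paths_between G v u" "vwalk_length q \<le> d" "(u, v) \<in> R"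
    "\<And>x. x \<in> set q - {v, u} \<Longrightarrow> (u, x) \<in> R"
    by (auto simp: weakly_reachable_def)
  have q': "set q \<subseteq> verts G" "set (vwalk_arcs q) \<subseteq> arcs_ends G" "q \<noteq> []" "distinct q"
    "hd q = v" "last q = u"
    using q(1) by (auto simp: paths_between_def vpath_def vwalk_def)
  have "v \<in> set q - {u}" using q' \<open>u \<noteq> v\<close> by (auto intro: hd_in_set)
  then obtain w where w: "w \<in> set q - {u}" "\<And>x. x \<in> set q - {u} \<Longrightarrow> (w, x) \<in> R"
    using finite_linear_order_on_has_least[OF lin, of "set q - {u}"] q' by auto
  from w obtain ys zs where s: "q = ys @ w # zs" by (auto dest: split_list)
  then have zs: "zs \<noteq> []" "u \<in> set zs" using q' w by (auto split: if_splits)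
  have p: "ys @ [w] \<in> paths_between G v w"
    using q' s vwalkI_append_l[of "ys @ [w]" zs G]
    by (auto simp: paths_between_def vpath_def vwalk_def hd_append split: if_splits)
  have "weakly_reachable G R (length ys) v w"
    unfolding weakly_reachable_def
  proof (intro conjI bexI[OF _ p] ballI)
    show "(w, v) \<in> R" using w \<open>v \<in> set q - {u}\<close> by blast
    fix x assume "x \<in> set (ys @ [w]) - {v, w}"
    then show "(w, x) \<in> R" "x \<noteq> w" using w(2)[of x] s q' zs by auto
  qed auto
  moreover have "length ys < d" using q(2) s zs by (cases zs) auto
  moreover have "(u, w) \<in> R" using q w by (cases "w = v") auto
  ultimately show ?thesis using that[of q _ w] q q' w by auto
qed

section \<open>The number of occupied levels\<close>

text \<open>\<open>K \<ge> k\<close> absorbs the number of internal vertices of a path,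
  \<open>K \<ge> a\<close> turns growth by levels into the growth in condition (ii), and
  \<open>K \<ge> 2\<close> separates the levels.\<close>

lemma (in sym_digraph) card_levels_le:
  fixes r :: "'a \<Rightarrow> real" and K a e k :: nat and lev :: "'a \<Rightarrow> nat"
  assumes fin: "finite (verts G)"
    and pos: "\<And>v. v \<in> verts G \<Longrightarrow> r v > 0"
    and lin: "linear_order_on (verts G) R"
    and mono: "\<And>u v. (u, v) \<in> R \<Longrightarrow> u \<noteq> v \<Longrightarrow> r u \<ge> r v"
    and P: "property_P G r f a e"
    and v: "v \<in> verts G"
    and K: "K \<ge> 2" "K \<ge> k" "K \<ge> a"
    and U: "U = {u \<in> verts G. weakly_reachable G R k v u}"
    and lev: "\<And>u. u \<in> U \<Longrightarrow> real K ^ lev u * r v \<le> r u \<and> r u < real K ^ Suc (lev u) * r v"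
  shows "card (lev ` U) \<le> (k + e + 2) choose (e + 2)"
proof -
  have rv: "r v > 0" using pos v by auto
  define L where "L = lev ` U"
  have finU: "finite U" using fin U by auto
  have lev_mono: "lev x \<le> lev y" if "x \<in> U" "y \<in> U" "r x \<le> r y" for x y
  proof -
    have "real K ^ lev x * r v < real K ^ Suc (lev y) * r v"
      using lev[of x] lev[of y] that by linarith
    then have "real K ^ lev x < real K ^ Suc (lev y)" using rv by auto
    then have "lev x < Suc (lev y)" using K by (intro power_less_imp_less_exp[of "real K"]) auto
    then show ?thesis by simp
  qed
  have lev_v: "lev v = 0" if "v \<in> U"
  proof -
    have "real K ^ lev v \<le> 1" using lev[OF that] rv by auto
    then show ?thesis using K one_less_power[of "real K" "lev v"] by linarith
  qed
  have mono': "r w \<ge> r x" if "(w, x) \<in> R" for w x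
    using mono that by (cases "w = x") auto
  define reach where "reach l j \<longleftrightarrow> (\<exists>u \<in> U. lev u = j \<and> weakly_reachable G R l v u)" for l j
  \<comment> \<open>The \<open>LEAST\<close> is evaluated only for \<open>j\<close> in
    \<open>L\<close>, where \<open>k\<close> is a candidate.\<close>
  define d where "d j = (LEAST l. reach l j)" for j
  have reach_k: "reach k j" if "j \<in> L" for j
    using that U by (auto simp: L_def reach_def)
  have d_le: "d j \<le> k" if "j \<in> L" for j
    unfolding d_def by (rule Least_le) (rule reach_k[OF that])
  have "\<exists>u w q. u \<in> U \<and> lev u = j \<and> w \<in> U \<and> lev w < j \<and> d (lev w) < d j \<and>
      q \<in> paths_between G v u \<and> vwalk_length q \<le> k \<and> (\<forall>x \<in> set q - {u}. r x \<le> r w)"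
    if j: "j \<in> L" "j \<noteq> 0" for j
  proof -
    have "reach (d j) j" unfolding d_def by (rule LeastI) (rule reach_k[OF j(1)])
    then obtain u where u: "u \<in> U" "lev u = j" "weakly_reachable G R (d j) v u"
      by (auto simp: reach_def)
    have uv: "u \<noteq> v" using u j lev_v by auto
    obtain q w d' where w: "q \<in> paths_between G v u" "vwalk_length q \<le> d j" "d' < d j"
      "w \<in> verts G" "weakly_reachable G R d' v w" "(u, w) \<in> R" "w \<noteq> u"
      "\<And>x. x \<in> set q - {u} \<Longrightarrow> (w, x) \<in> R"
      by (rule weakly_reachable_least_vertex_before_end[OF lin u(3) uv]) (rule that)
    have "d' \<le> k" using w d_le[OF j(1)] by auto
    then have wU: "w \<in> U" using weakly_reachable_mono[OF w(5)] w(4) U by simp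
    have "reach d' (lev w)" using w wU by (auto simp: reach_def)
    then have "d (lev w) \<le> d'" unfolding d_def by (rule Least_le)
    then have dw: "d (lev w) < d j" using w by auto
    \<comment> \<open>The ordering gives only a weak inequality. It is strict because
      \<open>d j\<close> is the least number of steps over all of level \<open>j\<close>, and
      \<open>w\<close> needs fewer.\<close>
    have "lev w \<le> j" using lev_mono[OF wU u(1)] u(2) mono'[OF w(6)] by auto
    moreover have "lev w \<noteq> j" using dw by auto
    ultimately show ?thesis using u w wU dw d_le[OF j(1)] mono'
      by (intro exI[of _ u] exI[of _ w] exI[of _ q]) auto
  qed
  then obtain u w q where uwq: "\<And>j. j \<in> L \<Longrightarrow> j \<noteq> 0 \<Longrightarrow> u j \<in> U \<and> lev (u j) = j \<and> w j \<in> U \<and>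
      lev (w j) < j \<and> d (lev (w j)) < d j \<and> q j \<in> paths_between G v (u j) \<and>
      vwalk_length (q j) \<le> k \<and> (\<forall>x \<in> set (q j) - {u j}. r x \<le> r (w j))"
    by metis
  have "card L \<le> (k + (e + 2)) choose (e + 2)"
  proof (rule card_le_choose_of_bounded_cuts[where d = d and p = "\<lambda>j. lev (w j)"])
    show "finite L" using finU by (simp add: L_def)
    show "d j \<le> k" if "j \<in> L" for j using d_le that .
    show "lev (w j) \<in> L \<and> lev (w j) < j \<and> d (lev (w j)) < d j" if "j \<in> L" "j \<noteq> 0" for j
      using uwq[OF that] by (auto simp: L_def)
    fix i assume i: "i \<in> L"
    define C where "C = {j \<in> L. i < j \<and> lev (w j) \<le> i}"
    define xs where "xs = sorted_list_of_set C"
    have finC: "finite C" using finU by (simp add: C_def L_def)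
    then have xs: "set xs = C" "sorted_wrt (<) xs" "length xs = card C"
      by (auto simp: xs_def)
    have nth_ge: "i + Suc t \<le> xs ! t" if "t < length xs" for t
      using that
    proof (induction t)
      case 0
      then have "xs ! 0 \<in> C" using xs by (metis nth_mem)
      then show ?case by (simp add: C_def)
    next
      case (Suc t)
      then have "xs ! t < xs ! Suc t"
        using xs(2) by (simp add: sorted_wrt_nth_less)
      then show ?case using Suc by simp
    qed
    \<comment> \<open>Condition (ii) is used with \<open>s = K ^ (i + 2)\<close>. Entry
      \<open>t\<close> of \<open>us\<close> comes from a level at least \<open>i + t + 3\<close>, so
      its radius is at least \<open>K ^ (t + 1) * s * r v\<close>. The two dropped entries may lie
      in levels \<open>i + 1\<close> and \<open>i + 2\<close>, which is too low.\<close>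
    define us where "us = map u (drop 2 xs)"
    have Cu: "j \<in> C \<Longrightarrow> j \<in> L \<and> j \<noteq> 0" for j by (auto simp: C_def)
    have "length us \<le> e"
    proof -
      have sub: "set us \<subseteq> verts G"
        using uwq Cu xs U set_drop_subset[of 2 xs] by (fastforce simp: us_def)
      have dist: "distinct us"
      proof -
        \<comment> \<open>The index is recovered from the vertex by
          \<open>lev (u j) = j\<close>.\<close>
        have "inj_on u C" using uwq Cu by (metis inj_onI)
        then have "inj_on u (set (drop 2 xs))"
          using xs set_drop_subset[of 2 xs] by (metis inj_on_subset)
        moreover have "distinct xs" by (simp add: xs_def)
        ultimately show ?thesis by (simp add: us_def distinct_map)
      qed
      have entry: "lambda_dist G r (us ! t) v \<le> ereal (real (K ^ (i + 2)) * r v) \<and>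
          real a ^ (t + 1) * real (K ^ (i + 2)) * r v \<le> r (us ! t)" if t: "t < length us" for t
      proof -
        define j where "j = xs ! (t + 2)"
        have tl: "t + 2 < length xs" using t by (simp add: us_def)
        have uj: "us ! t = u j" using t by (simp add: us_def j_def add.commute)
        have jC: "j \<in> C" using tl xs by (metis j_def nth_mem)
        note J = uwq[OF Cu[OF jC, THEN conjunct1] Cu[OF jC, THEN conjunct2]]
        have wj: "r (w j) \<le> real K ^ Suc i * r v"
        proof -
          have "r (w j) \<le> real K ^ Suc (lev (w j)) * r v" using lev[of "w j"] J by auto
          also have "\<dots> \<le> real K ^ Suc i * r v"
            using jC K rv by (intro mult_right_mono power_increasing) (auto simp: C_def)
          finally show ?thesis .
        qed
        \<comment> \<open>Each of the at most \<open>k - 1\<close> internal vertices has radius at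
          most \<open>r (w j)\<close>; one more factor \<open>K\<close> pays for their
          number.\<close>
        have "lambda_dist G r (u j) v \<le> ereal (real (k - 1) * (real K ^ Suc i * r v))"
          using J wj rv by (intro lambda_dist_le[of "q j"]) force+
        also have "real (k - 1) * (real K ^ Suc i * r v) \<le> real K * (real K ^ Suc i * r v)"
          using K rv by (intro mult_right_mono) auto
        finally have 1: "lambda_dist G r (u j) v \<le> ereal (real (K ^ (i + 2)) * r v)"
          by (simp add: mult.assoc)
        have "real a ^ (t + 1) * real (K ^ (i + 2)) * r v
            \<le> real K ^ (t + 1) * real (K ^ (i + 2)) * r v"
          using K rv by (intro mult_right_mono power_mono) auto
        also have "\<dots> = real K ^ (i + Suc (t + 2)) * r v"
          by (simp add: power_add mult_ac)
        also have "\<dots> \<le> real K ^ j * r v"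
          using nth_ge[OF tl] K rv unfolding j_def by (intro mult_right_mono power_increasing) auto
        also have "\<dots> \<le> r (u j)" using lev[of "u j"] J by auto
        finally show ?thesis using 1 uj by simp
      qed
      have "K ^ (i + 2) \<ge> 1" using K by simp
      from P[unfolded property_P_def, THEN conjunct2, THEN bspec, OF v, THEN spec, THEN mp, OF this]
      show ?thesis using sub dist entry by blast
    qed
    then show "card C \<le> e + 2" using xs by (simp add: us_def)
  qed
  then show ?thesis by (simp add: L_def add.assoc)
qed

section \<open>Dyadic classes and the final count\<close>

text \<open>Internal vertices of a witnessing path come after \<open>u\<close>, so each has radius
  at most \<open>r u < 2 ^ Suc n * r v\<close>. At most \<open>k - 1\<close> of them cost at most
  \<open>(2 * k - 2) * 2 ^ n * r v\<close>, and condition (i) applies with \<open>s = 2 ^ n\<close>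
  and \<open>p = 2 * k - 2\<close>.\<close>

lemma (in sym_digraph) card_weakly_reachable_dyadic_le:
  assumes fin: "finite (verts G)"
    and pos: "\<And>v. v \<in> verts G \<Longrightarrow> r v > 0"
    and mono: "\<And>u v. (u, v) \<in> R \<Longrightarrow> u \<noteq> v \<Longrightarrow> r u \<ge> r v"
    and P: "property_P G r f a e"
    and v: "v \<in> verts G"
  shows "card {u \<in> verts G. weakly_reachable G R k v u \<and>
    2 ^ n * r v \<le> r u \<and> r u < 2 ^ Suc n * r v} \<le> f (2 * k - 2)" (is "card ?A \<le> _")
proof -
  have rv: "r v > 0" using pos v by auto
  have "lambda_dist G r u v \<le> ereal (real (2 * k - 2) * real (2 ^ n) * r v)" if "u \<in> ?A" for u
  proof -
    from that obtain q where q: "q \<in> paths_between G v u" "vwalk_length q \<le> k"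
      "\<And>x. x \<in> set q - {v, u} \<Longrightarrow> r x \<le> r u"
      using mono by (fastforce simp: weakly_reachable_def)
    have "r u > 0" using that pos by auto
    then have "lambda_dist G r u v \<le> ereal (real (k - 1) * r u)"
      using q by (intro lambda_dist_le) auto
    also have "real (k - 1) * r u \<le> real (k - 1) * (2 ^ Suc n * r v)"
      using that by (intro mult_left_mono) auto
    also have "\<dots> = real (2 * k - 2) * real (2 ^ n) * r v"
      by (cases k) auto
    finally show ?thesis by simp
  qed
  then have "card ?A \<le> card {u \<in> verts G. r u \<ge> real (2 ^ n) * r v \<and>
      lambda_dist G r u v \<le> ereal (real (2 * k - 2) * real (2 ^ n) * r v)}"
    using fin by (intro card_mono) auto
  also have "\<dots> \<le> f (2 * k - 2)"
    using P v unfolding property_P_def by (auto simp del: of_nat_power)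
  finally show ?thesis .
qed

theorem theorem8:
  fixes G :: "('a, 'b) pre_digraph"
    and r :: "'a \<Rightarrow> real"
    and R :: "'a rel"
    and f :: "nat \<Rightarrow> nat"
    and a e k :: nat
  assumes "graph G"
    and "\<And>p. f p > 0"
    and "a > 0" and "e > 0"
    and "\<And>v. v \<in> verts G \<Longrightarrow> r v > 0"
    and "linear_order_on (verts G) R"
    and "\<And>u v. (u, v) \<in> R \<Longrightarrow> u \<noteq> v \<Longrightarrow> r u \<ge> r v"
    and "property_P G r f a e"
    and "k \<ge> a"
  shows "int (wcol G R k) \<le>
    max 1 \<lceil>log 2 (real k)\<rceil> * int (f (2 * k - 2)) * int ((k + e + 2) choose (e + 2))"
proof -
  interpret graph G by fact
  have fin: "finite (verts G)" by simp
  \<comment> \<open>For \<open>k = 1\<close> the logarithm is \<open>0\<close>; the maximum ensures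
    \<open>K \<ge> 2\<close> there too.\<close>
  define b where "b = nat (max 1 \<lceil>log 2 (real k)\<rceil>)"
  have b: "b \<ge> 1" "int b = max 1 \<lceil>log 2 (real k)\<rceil>" by (auto simp: b_def)
  define K :: nat where "K = 2 ^ b"
  have K2: "K \<ge> 2" using power_increasing[of 1 b "2::nat"] b by (simp add: K_def)
  have Kk: "K \<ge> k"
  proof -
    have "k > 0" using assms by simp
    have "log 2 (real k) \<le> real b" using b(2) by linarith
    then have "real k \<le> 2 powr real b" using \<open>k > 0\<close> by (simp add: log_le_iff)
    then have "real k \<le> real (2 ^ b)" by (simp add: powr_realpow)
    then show ?thesis unfolding K_def by linarith
  qed
  have main: "card {u \<in> verts G. weakly_reachable G R k v u}
      \<le> b * f (2 * k - 2) * ((k + e + 2) choose (e + 2))" if v: "v \<in> verts G" for v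
  proof -
    have rv: "r v > 0" using assms v by auto
    define U where "U = {u \<in> verts G. weakly_reachable G R k v u}"
    \<comment> \<open>For \<open>u\<close> in \<open>U\<close> the quotient is at least
      \<open>1\<close>, so \<open>nat\<close> truncates nothing.\<close>
    define D where "D u = nat \<lfloor>log 2 (r u / r v)\<rfloor>" for u
    have D: "2 ^ D u * r v \<le> r u \<and> r u < 2 ^ Suc (D u) * r v" if "u \<in> U" for u
    proof -
      have "r v \<le> r u"
        using that assms(7)[of u v] by (cases "u = v") (auto simp: U_def weakly_reachable_def)
      then have x: "r u / r v \<ge> 1" using rv by simp
      then have "log 2 (r u / r v) \<ge> 0" by simp
      then have "real (D u) \<le> log 2 (r u / r v)" "log 2 (r u / r v) < real (Suc (D u))"
        unfolding D_def by linarith+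
      then have "2 powr real (D u) \<le> r u / r v" "r u / r v < 2 powr real (Suc (D u))"
        using x by (simp_all add: le_log_iff log_less_iff)
      then show ?thesis using rv by (simp add: powr_realpow field_simps powr_add)
    qed
    \<comment> \<open>As \<open>K = 2 ^ b\<close>, level \<open>l\<close> is the union of the
      \<open>b\<close> dyadic classes with indices from \<open>l * b\<close> to
      \<open>l * b + b - 1\<close>.\<close>
    define lev where "lev u = D u div b" for u
    have lev: "real K ^ lev u * r v \<le> r u \<and> r u < real K ^ Suc (lev u) * r v" if "u \<in> U" for u
    proof -
      have "b * lev u \<le> D u" "Suc (D u) \<le> b * Suc (lev u)"
        using b dividend_less_times_div[of b "D u"] by (auto simp: lev_def Suc_le_eq)
      then have "(2::real) ^ (b * lev u) \<le> 2 ^ D u" "(2::real) ^ Suc (D u) \<le> 2 ^ (b * Suc (lev u))"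
        by (intro power_increasing; simp)+
      then have "(2::real) ^ (b * lev u) * r v \<le> 2 ^ D u * r v"
        "(2::real) ^ Suc (D u) * r v \<le> 2 ^ (b * Suc (lev u)) * r v"
        using rv by (auto intro: mult_right_mono)
      then have "(2::real) ^ (b * lev u) * r v \<le> r u" "r u < 2 ^ (b * Suc (lev u)) * r v"
        using D[OF that] by linarith+
      then show ?thesis by (simp only: K_def of_nat_power of_nat_numeral power_mult)
    qed
    have cardL: "card (lev ` U) \<le> (k + e + 2) choose (e + 2)"
      using fin assms(5-8) v K2 Kk order_trans[OF assms(9) Kk] U_def lev
      by (rule card_levels_le)
    define A where "A n = {u \<in> verts G. weakly_reachable G R k v u \<and>
      2 ^ n * r v \<le> r u \<and> r u < 2 ^ Suc n * r v}" for n
    define T where "T = (\<Union>l \<in> lev ` U. \<Union>t < b. A (l * b + t))"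
    have finA: "finite (A n)" for n using fin by (simp add: A_def)
    have finU: "finite U" using fin by (simp add: U_def)
    have cardA: "card (A n) \<le> f (2 * k - 2)" for n
      unfolding A_def
      using fin assms(5,7,8) v by (rule card_weakly_reachable_dyadic_le)
    have "U \<subseteq> T"
    proof
      fix u assume u: "u \<in> U"
      have "u \<in> A (lev u * b + D u mod b)"
        using D[OF u] u by (simp add: A_def U_def lev_def)
      moreover have "D u mod b < b" using b by simp
      ultimately show "u \<in> T" using u by (auto simp: T_def)
    qed
    then have "card U \<le> card T"
      using finA finU by (intro card_mono) (auto simp: T_def)
    also have "\<dots> \<le> (\<Sum>l \<in> lev ` U. card (\<Union>t < b. A (l * b + t)))"
      unfolding T_def using finU by (intro card_UN_le) auto
    also have "\<dots> \<le> (\<Sum>l \<in> lev ` U. b * f (2 * k - 2))"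
    proof (rule sum_mono)
      fix l
      have "card (\<Union>t < b. A (l * b + t)) \<le> (\<Sum>t < b. card (A (l * b + t)))"
        by (intro card_UN_le) auto
      also have "\<dots> \<le> b * f (2 * k - 2)"
        using sum_bounded_above[of "{..<b}" "\<lambda>t. card (A (l * b + t))" "f (2 * k - 2)"] cardA by simp
      finally show "card (\<Union>t < b. A (l * b + t)) \<le> b * f (2 * k - 2)" .
    qed
    also have "\<dots> = card (lev ` U) * (b * f (2 * k - 2))" by simp
    also have "\<dots> \<le> ((k + e + 2) choose (e + 2)) * (b * f (2 * k - 2))"
      using cardL by (rule mult_right_mono) simp
    finally show ?thesis by (simp add: U_def mult_ac)
  qed
  have "wcol G R k \<le> b * f (2 * k - 2) * ((k + e + 2) choose (e + 2))"
    unfolding wcol_def using main fin by (subst Max_le_iff) auto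
  then have "int (wcol G R k) \<le> int (b * f (2 * k - 2) * ((k + e + 2) choose (e + 2)))"
    by (rule of_nat_mono)
  then show ?thesis by (simp only: of_nat_mult b(2))
qed

end
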